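(* Let $G=(V,E)$ be a finite graph (loops and multiple edges allowed) with $|E|=n$, let $f\in \mathrm{Hom}_d(n)$ be a homogeneous function of degree $d$, let $e\in E$ be an edge of $G$, and let $s:E\to\Omega=\{1,\dots,n\}$ be a label of $G$. Then $$\chi_f(G(s);\lambda)=\widetilde f(s(e))\circ \chi_f(G(s)\backslash e;\lambda)-\chi_f(G(s)/e;\lambda).$$
   Context: Let $\Omega=\{1,\dots,n\}$ and $\Omega_d=\{Z\subset\Omega:|Z|=d\}$. $\mathrm{Hom}_d(n)$ is the real vector space of formal sums $f=\sum_{Z\in\Omega_d}f(Z)Z$, identified with functions $f:\Omega_d\to\mathbb R$. For $X\subset\Omega$ put $\widetilde f(X)=\sum_{Z\in\Omega_d,\,Z\subset X}f(Z)$. A label of $G=(V,E)$ with $|E|=n$ is a bijection $s:E\to\Omega$; $G(s)$ denotes $G$ with edges indexed by $s$. For $A\subset E$, $G_A=(V,A)$ and $k(G_A)$ is its number of connected components. The weighted chromatic polynomial is $$\chi_f(G(s);\lambda)=\sum_{A\subset E}\widetilde f(s(E\setminus A))(-1)^{|A|}\lambda^{k(G_A)}.$$ $G\backslash e$ is the graph obtained by removing $e$, and $G/e$ is obtained by identifying the end vertices of $e$ (and removing $e$), all other adjacencies being kept (so $G/e=G\backslash e$ if $e$ is a loop). $G(s)\backslash e$ and $G(s)/e$ have edge set $E\setminus\{e\}$, labelled by the restriction of $s$ (an injective map into the same $\Omega$), and $\chi_f$ of them is given by the same formula with the same $f$, with edge set $E\setminus\{e\}$ in place of $E$. Operator $\circ$: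 $\widetilde f(X)\circ\widetilde f(Y):=\widetilde f(X\cup Y)$, extended distributively over sums and scalar (polynomial) multiples. It acts on expressions regarded as formal linear combinations of the symbols $\widetilde f(Y)$, $Y\subset\Omega$; with $\widetilde f(s(e))=\widetilde f(\{s(e)\})$, the operation $\widetilde f(s(e))\circ$ replaces each symbol $\widetilde f(Y)$ by $\widetilde f(Y\cup\{s(e)\})$. Thus $\widetilde f(s(e))\circ\chi_f(G(s)\backslash e;\lambda)=\sum_{A\subset E\setminus\{e\}}\widetilde f\big(s((E\setminus\{e\})\setminus A)\cup\{s(e)\}\big)(-1)^{|A|}\lambda^{k((G\backslash e)_A)}$. *)

theory Defs
  imports
    "HOL-Computational_Algebra.Polynomial"
    "HOL-Library.Poly_Mapping"
    "HOL-Library.FuncSet"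
begin

section \<open>Finite multigraphs with loops\<close>

text \<open>An edge \<open>a\<close> carries the set \<open>ends G a\<close> of its end vertices: two vertices for an ordinary
  edge, one for a loop. Multiple edges are distinct edges with the same ends.\<close>

record ('v, 'e) multigraph =
  verts :: "'v set"
  edges :: "'e set"
  ends :: "'e \<Rightarrow> 'v set"

definition finite_graph :: "('v, 'e) multigraph \<Rightarrow> bool" where
  "finite_graph G \<longleftrightarrow> finite (verts G) \<and> finite (edges G) \<and>
     (\<forall>a\<in>edges G. ends G a \<subseteq> verts G \<and> card (ends G a) \<in> {1, 2})"

definition adjacency :: "('v, 'e) multigraph \<Rightarrow> 'v rel" where
  "adjacency G = {(u, v). \<exists>a\<in>edges G. ends G a = {u, v}}"

definition connectedness :: "('v, 'e) multigraph \<Rightarrow> 'v rel" where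
  "connectedness G = {(u, v) \<in> verts G \<times> verts G. (u, v) \<in> (adjacency G)\<^sup>*}"

definition num_components :: "('v, 'e) multigraph \<Rightarrow> nat" where
  "num_components G = card (verts G // connectedness G)"

definition spanning :: "('v, 'e) multigraph \<Rightarrow> 'e set \<Rightarrow> ('v, 'e) multigraph" where
  "spanning G A = G\<lparr>edges := A\<rparr>"

definition delete_edge :: "('v, 'e) multigraph \<Rightarrow> 'e \<Rightarrow> ('v, 'e) multigraph" where
  "delete_edge G e = G\<lparr>edges := edges G - {e}\<rparr>"

text \<open>Identifying the end vertices of \<open>e\<close> is taking the quotient of the vertex set, so the vertices
  of the contraction are the classes: the set of ends of \<open>e\<close> and the remaining singletons. If \<open>e\<close>
  is a loop, all classes are singletons and the contraction is the deletion of \<open>e\<close> with each vertex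
  \<open>v\<close> renamed to \<open>{v}\<close>.\<close>

definition merge_class :: "('v, 'e) multigraph \<Rightarrow> 'e \<Rightarrow> 'v \<Rightarrow> 'v set" where
  "merge_class G e v = (if v \<in> ends G e then ends G e else {v})"

definition contract_edge :: "('v, 'e) multigraph \<Rightarrow> 'e \<Rightarrow> ('v set, 'e) multigraph" where
  "contract_edge G e =
     \<lparr>verts = merge_class G e ` verts G,
      edges = edges G - {e},
      ends = (\<lambda>a. merge_class G e ` ends G a)\<rparr>"

lemma finite_graph_delete_edge: "finite_graph G \<Longrightarrow> finite_graph (delete_edge G e)"
  by (auto simp: finite_graph_def delete_edge_def)

lemma finite_graph_contract_edge:
  assumes "finite_graph G"
  shows "finite_graph (contract_edge G e)"
proof -
  have "card (merge_class G e ` ends G a) \<in> {1, 2}" if "a \<in> edges G" for a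
  proof -
    have c: "card (ends G a) \<in> {1, 2}"
      using assms that by (auto simp: finite_graph_def)
    then have f: "finite (ends G a)" "ends G a \<noteq> {}"
      by (auto intro: card_ge_0_finite)
    have "card (merge_class G e ` ends G a) \<le> 2"
      using card_image_le[OF f(1), of "merge_class G e"] c by auto
    moreover have "card (merge_class G e ` ends G a) > 0"
      using f by (simp add: card_gt_0_iff)
    ultimately show ?thesis by auto
  qed
  with assms show ?thesis
    by (auto simp: finite_graph_def contract_edge_def)
qed


section \<open>Homogeneous functions\<close>

definition dsubsets :: "nat \<Rightarrow> nat \<Rightarrow> nat set set" where
  "dsubsets n d = {Z. Z \<subseteq> {1..n} \<and> card Z = d}"

definition Hom :: "nat \<Rightarrow> nat \<Rightarrow> (nat set \<Rightarrow> real) set" where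
  "Hom d n = dsubsets n d \<rightarrow>\<^sub>E UNIV"

definition ftilde :: "nat \<Rightarrow> nat \<Rightarrow> (nat set \<Rightarrow> real) \<Rightarrow> nat set \<Rightarrow> real" where
  "ftilde n d f X = (\<Sum>Z | Z \<in> dsubsets n d \<and> Z \<subseteq> X. f Z)"


section \<open>The weighted chromatic polynomial\<close>

text \<open>A label is a function on edges of which only the values on the edge set of the graph matter, so
  the restriction of a label to a smaller edge set is the same function. The variable \<open>\<lambda>\<close> is the
  indeterminate of \<^typ>\<open>real poly\<close>.\<close>

definition wchrom ::
  "nat \<Rightarrow> nat \<Rightarrow> (nat set \<Rightarrow> real) \<Rightarrow> ('v, 'e) multigraph \<Rightarrow> ('e \<Rightarrow> nat) \<Rightarrow> real poly" where
  "wchrom n d f G s = (\<Sum>A\<in>Pow (edges G).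
     smult (ftilde n d f (s ` (edges G - A)))
       ((- 1) ^ card A * monom 1 (num_components (spanning G A))))"


section \<open>Formal linear combinations and the operator\<close>

text \<open>The operator is not well defined on polynomials, only on formal linear combinations of the
  symbols for \<open>f~(Y)\<close> with polynomial coefficients. Such a combination is a finitely
  supported map, \<open>Poly_Mapping.single Y c\<close> being \<open>c\<close> times the symbol of \<open>Y\<close>. The operator is the
  bilinear extension of union of symbols, \<open>realize\<close> substitutes the actual values, and
  \<open>formal_wchrom\<close> is the defining sum of the weighted chromatic polynomial left unevaluated.\<close>

type_synonym formal = "nat set \<Rightarrow>\<^sub>0 real poly"

definition symb :: "nat set \<Rightarrow> formal" where
  "symb Y = Poly_Mapping.single Y 1"

definition circ :: "formal \<Rightarrow> formal \<Rightarrow> formal" where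
  "circ p q = (\<Sum>X\<in>Poly_Mapping.keys p. \<Sum>Y\<in>Poly_Mapping.keys q.
     Poly_Mapping.single (X \<union> Y) (Poly_Mapping.lookup p X * Poly_Mapping.lookup q Y))"

definition realize :: "nat \<Rightarrow> nat \<Rightarrow> (nat set \<Rightarrow> real) \<Rightarrow> formal \<Rightarrow> real poly" where
  "realize n d f p =
     (\<Sum>Y\<in>Poly_Mapping.keys p. smult (ftilde n d f Y) (Poly_Mapping.lookup p Y))"

definition formal_wchrom :: "('v, 'e) multigraph \<Rightarrow> ('e \<Rightarrow> nat) \<Rightarrow> formal" where
  "formal_wchrom G s = (\<Sum>A\<in>Pow (edges G).
     Poly_Mapping.single (s ` (edges G - A))
       ((- 1) ^ card A * monom 1 (num_components (spanning G A))))"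

lemma realize_superset:
  assumes "finite S" "Poly_Mapping.keys p \<subseteq> S"
  shows "realize n d f p = (\<Sum>Y\<in>S. smult (ftilde n d f Y) (Poly_Mapping.lookup p Y))"
  unfolding realize_def
  by (rule sum.mono_neutral_left) (use assms in \<open>auto simp: in_keys_iff\<close>)

lemma realize_add: "realize n d f (p + q) = realize n d f p + realize n d f q"
proof -
  let ?S = "Poly_Mapping.keys p \<union> Poly_Mapping.keys q"
  have "finite ?S" by simp
  then show ?thesis
    using Poly_Mapping.keys_add[of p q]
    by (simp add: realize_superset[of ?S] lookup_add smult_add_right sum.distrib)
qed

lemma realize_sum: "realize n d f (sum g I) = (\<Sum>i\<in>I. realize n d f (g i))"
  by (induction I rule: infinite_finite_induct) (auto simp: realize_add, simp_all add: realize_def)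

lemma realize_single: "realize n d f (Poly_Mapping.single Y c) = smult (ftilde n d f Y) c"
  by (subst realize_superset[of "{Y}"]) auto

lemma realize_formal_wchrom: "realize n d f (formal_wchrom G s) = wchrom n d f G s"
  by (simp add: formal_wchrom_def wchrom_def realize_sum realize_single)

lemma circ_symb_superset:
  assumes "finite S" "Poly_Mapping.keys q \<subseteq> S"
  shows "circ (symb X) q = (\<Sum>Y\<in>S. Poly_Mapping.single (X \<union> Y) (Poly_Mapping.lookup q Y))"
  unfolding circ_def symb_def
  by (simp, rule sum.mono_neutral_left) (use assms in \<open>auto simp: in_keys_iff\<close>)

lemma circ_symb_add: "circ (symb X) (p + q) = circ (symb X) p + circ (symb X) q"
proof -
  let ?S = "Poly_Mapping.keys p \<union> Poly_Mapping.keys q"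
  have "finite ?S" by simp
  then show ?thesis
    using Poly_Mapping.keys_add[of p q]
    by (simp add: circ_symb_superset[of ?S] lookup_add single_add sum.distrib)
qed

lemma circ_symb_sum: "circ (symb X) (sum g I) = (\<Sum>i\<in>I. circ (symb X) (g i))"
  by (induction I rule: infinite_finite_induct) (auto simp: circ_symb_add, simp_all add: circ_def)

lemma circ_symb_single:
  "circ (symb X) (Poly_Mapping.single Y c) = Poly_Mapping.single (X \<union> Y) c"
  by (subst circ_symb_superset[of "{Y}"]) auto

lemma realize_circ_formal_wchrom:
  "realize n d f (circ (symb X) (formal_wchrom G s)) =
     (\<Sum>A\<in>Pow (edges G). smult (ftilde n d f (s ` (edges G - A) \<union> X))
       ((- 1) ^ card A * monom 1 (num_components (spanning G A))))"
  by (simp add: formal_wchrom_def circ_symb_sum circ_symb_single realize_sum realize_single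
      Un_commute)

end

theory Submission imports Defs begin

text \<open>Split the subsets of the edge set by whether they contain \<open>e\<close>. Those avoiding \<open>e\<close>
  keep \<open>s e\<close> in the argument of \<open>f~\<close> and give the deletion term. Those of the form
  \<open>insert e A\<close> give the contraction term with one extra sign, because merging the ends of \<open>e\<close>
  induces a bijection between the components of the spanning subgraphs.\<close>

lemma sym_adjacency: "sym (adjacency G)"
  by (auto simp: sym_def adjacency_def insert_commute)

lemma equiv_connectedness: "equiv (verts G) (connectedness G)"
proof (rule equivI)
  show "connectedness G \<subseteq> verts G \<times> verts G" "refl_on (verts G) (connectedness G)"
    by (auto simp: connectedness_def refl_on_def)
  show "sym (connectedness G)"
    using sym_rtrancl[OF sym_adjacency[of G]] by (auto simp: connectedness_def sym_def)
  show "trans (connectedness G)"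
    by (auto simp: connectedness_def trans_def intro: rtrancl_trans)
qed

text \<open>The map \<open>m\<close> may glue points of \<open>V\<close>, but \<open>RS\<close>
  forces glued points to be \<open>R\<close>-related, since \<open>S\<close> is reflexive on the
  image. So \<open>m\<close> never glues different classes, and taking images of classes is a
  bijection between the quotients.\<close>

lemma card_quotient_image:
  assumes R: "equiv V R" and S: "equiv (m ` V) S"
    and RS: "\<And>u v. u \<in> V \<Longrightarrow> v \<in> V \<Longrightarrow> (u, v) \<in> R \<longleftrightarrow> (m u, m v) \<in> S"
  shows "card (V // R) = card ((m ` V) // S)"
proof -
  have sub: "R \<subseteq> V \<times> V" "S \<subseteq> m ` V \<times> m ` V"
    using R S by (auto simp: equiv_def)
  have im: "m ` (R `` {u}) = S `` {m u}" if "u \<in> V" for u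
    using sub that RS by blast
  have "inj_on ((`) m) (V // R)"
  proof (rule inj_onI)
    fix C D assume C: "C \<in> V // R" and D: "D \<in> V // R" and eq: "m ` C = m ` D"
    obtain u where u: "u \<in> V" "C = R `` {u}" using C by (rule quotientE)
    obtain v where v: "v \<in> V" "D = R `` {v}" using D by (rule quotientE)
    have "S `` {m u} = S `` {m v}" using eq u v by (simp add: im)
    then have "(u, v) \<in> R"
      using eq_equiv_class_iff[OF S] u v RS by blast
    then show "C = D" using equiv_class_eq[OF R] u v by simp
  qed
  moreover have "(`) m ` (V // R) = (m ` V) // S"
    unfolding quotient_def using im by (auto simp: image_iff)
  ultimately show ?thesis
    by (metis card_image)
qed

text \<open>Distinct vertices are merged only when they are the two ends of \<open>e\<close>, and
  then \<open>e\<close> itself, being in \<open>B\<close>, joins them.\<close>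

lemma merge_class_adjacent:
  assumes "merge_class G e u = merge_class G e v" "e \<in> B" "card (ends G e) \<in> {1, 2}"
  shows "(u, v) \<in> (adjacency (spanning G B))\<^sup>*"
proof (cases "u = v")
  case False
  have "u \<in> ends G e" "v \<in> ends G e"
    using assms(1) False by (auto simp: merge_class_def split: if_splits)
  then have "ends G e = {u, v}"
    using assms(3) False by (auto simp: card_1_singleton_iff card_2_iff)
  then have "(u, v) \<in> adjacency (spanning G B)"
    using assms(2) by (auto simp: adjacency_def spanning_def)
  then show ?thesis ..
qed simp

text \<open>Walks project and lift. Going down, a step along \<open>e\<close> collapses to a point
  and any other step stays a step. Going up, each edge lifts to itself, and where consecutive lifts
  meet in different representatives of one class, \<open>e\<close> bridges the gap.\<close>

lemma rtrancl_adjacency_contract_edge: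
  assumes card: "\<And>a. a \<in> insert e A \<Longrightarrow> card (ends G a) \<in> {1, 2}"
  shows "(u, v) \<in> (adjacency (spanning G (insert e A)))\<^sup>* \<longleftrightarrow>
    (merge_class G e u, merge_class G e v) \<in> (adjacency (spanning (contract_edge G e) A))\<^sup>*"
    (is "_ \<in> ?H\<^sup>* \<longleftrightarrow> (?m u, ?m v) \<in> ?K\<^sup>*")
proof
  assume "(u, v) \<in> ?H\<^sup>*"
  then show "(?m u, ?m v) \<in> ?K\<^sup>*"
  proof induction
    case (step v w)
    then obtain a where a: "a \<in> insert e A" "ends G a = {v, w}"
      by (auto simp: adjacency_def spanning_def)
    show ?case
    proof (cases "a = e")
      case True
      then have "?m v = ?m w" using a by (simp add: merge_class_def)
      then show ?thesis using step by simp
    next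
      case False
      then have "(?m v, ?m w) \<in> ?K"
        using a by (force simp: adjacency_def spanning_def contract_edge_def)
      then show ?thesis using step by simp
    qed
  qed simp
next
  have merged: "(x, y) \<in> ?H\<^sup>*" if "?m x = ?m y" for x y
    using that card by (intro merge_class_adjacent) auto
  \<comment> \<open>The walk ends in a class, so the induction must allow every representative
    \<open>w\<close> of it: the next edge may leave from a different one than the previous edge
    reached.\<close>
  have "(u, w) \<in> ?H\<^sup>*" if "(?m u, y) \<in> ?K\<^sup>*" "y = ?m w" for y w
    using that
  proof (induction arbitrary: w)
    case base
    then show ?case by (rule merged)
  next
    case (step y z)
    then obtain a where a: "a \<in> A" "?m ` ends G a = {y, z}"
      by (auto simp: adjacency_def spanning_def contract_edge_def)
    obtain p q where pq: "p \<in> ends G a" "q \<in> ends G a" "y = ?m p" "z = ?m q"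
      using a(2) by (metis imageE insertCI)
    have "(p, q) \<in> ?H\<^sup>*"
    proof -
      \<comment> \<open>If \<open>y = z\<close>, the chosen \<open>p\<close> and \<open>q\<close>
        may coincide even when \<open>a\<close> is not a loop in \<open>G\<close>; reflexivity of
        the closure covers that case.\<close>
      have "(p, q) \<in> ?H" if "p \<noteq> q"
      proof -
        have "card (ends G a) \<in> {1, 2}" using card a by blast
        then have "ends G a = {p, q}"
          using pq that by (auto simp: card_1_singleton_iff card_2_iff)
        then show ?thesis
          using a by (auto simp: adjacency_def spanning_def)
      qed
      then show ?thesis by blast
    qed
    \<comment> \<open>The lifted walk goes from \<open>u\<close> to \<open>p\<close> by induction,
      on to \<open>q\<close> along \<open>a\<close>, and finally to \<open>w\<close>, which has the
      same class as \<open>q\<close>.\<close>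
    with step.IH[OF pq(3)] merged[of q w] pq(4) step.prems show ?case
      by (meson rtrancl_trans)
  qed
  then show "(u, v) \<in> ?H\<^sup>*" if "(?m u, ?m v) \<in> ?K\<^sup>*"
    using that by blast
qed

lemma num_components_contract_edge:
  assumes "finite_graph G" "e \<in> edges G" "A \<subseteq> edges G"
  shows "num_components (spanning (contract_edge G e) A) =
    num_components (spanning G (insert e A))"
proof -
  let ?H = "spanning G (insert e A)" and ?K = "spanning (contract_edge G e) A"
  have V: "verts ?H = verts G" "verts ?K = merge_class G e ` verts G"
    by (simp_all add: spanning_def contract_edge_def)
  have reach: "(u, v) \<in> (adjacency ?H)\<^sup>* \<longleftrightarrow>
      (merge_class G e u, merge_class G e v) \<in> (adjacency ?K)\<^sup>*" for u v
    using assms by (intro rtrancl_adjacency_contract_edge) (auto simp: finite_graph_def)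
  have "card (verts G // connectedness ?H) =
      card ((merge_class G e ` verts G) // connectedness ?K)"
  proof (rule card_quotient_image)
    show "equiv (verts G) (connectedness ?H)"
      "equiv (merge_class G e ` verts G) (connectedness ?K)"
      using equiv_connectedness[of ?H] equiv_connectedness[of ?K] by (simp_all add: V)
    show "(u, v) \<in> connectedness ?H \<longleftrightarrow>
        (merge_class G e u, merge_class G e v) \<in> connectedness ?K"
      if "u \<in> verts G" "v \<in> verts G" for u v
      using that by (simp add: connectedness_def V reach)
  qed
  then show ?thesis
    by (simp add: num_components_def V)
qed

lemma sum_Pow_remove:
  fixes g :: "'a set \<Rightarrow> 'b::comm_monoid_add"
  assumes "finite E" "e \<in> E"
  shows "sum g (Pow E) = (\<Sum>A\<in>Pow (E - {e}). g A) + (\<Sum>A\<in>Pow (E - {e}). g (insert e A))"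
proof -
  have "Pow E = Pow (E - {e}) \<union> insert e ` Pow (E - {e})"
    using assms(2) by (metis Pow_insert insert_Diff)
  moreover have "inj_on (insert e) (Pow (E - {e}))"
    by (rule inj_onI) blast
  moreover have "Pow (E - {e}) \<inter> insert e ` Pow (E - {e}) = {}"
    by blast
  ultimately show ?thesis
    using assms(1) by (simp add: sum.union_disjoint sum.reindex)
qed

theorem proposition3p1:
  fixes G :: "('v, 'e) multigraph"
    and f :: "nat set \<Rightarrow> real"
    and s :: "'e \<Rightarrow> nat"
    and e :: 'e
    and n d :: nat
  assumes "finite_graph G"
    and "card (edges G) = n"
    and "f \<in> Hom d n"
    and "e \<in> edges G"
    and "bij_betw s (edges G) {1..n}"
  shows "wchrom n d f G s =
    realize n d f (circ (symb {s e}) (formal_wchrom (delete_edge G e) s))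
      - wchrom n d f (contract_edge G e) s"
proof -
  let ?E = "edges G"
  let ?t = "\<lambda>A. smult (ftilde n d f (s ` (?E - A)))
    ((- 1) ^ card A * monom 1 (num_components (spanning G A)))"
  have fin: "finite ?E"
    using assms(1) by (simp add: finite_graph_def)
  have del: "realize n d f (circ (symb {s e}) (formal_wchrom (delete_edge G e) s)) =
      (\<Sum>A\<in>Pow (?E - {e}). ?t A)"
    unfolding realize_circ_formal_wchrom
  proof (rule sum.cong)
    fix A assume "A \<in> Pow (?E - {e})"
    \<comment> \<open>Adjoining \<open>s e\<close> to the symbol turns the complement of
      \<open>A\<close> in the deleted graph into its complement in all of \<open>G\<close>.\<close>
    then have "?E - A = insert e (?E - {e} - A)"
      using assms(4) by blast
    then have "s ` (edges (delete_edge G e) - A) \<union> {s e} = s ` (?E - A)"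
      by (simp add: delete_edge_def)
    moreover have "spanning (delete_edge G e) A = spanning G A"
      by (simp add: spanning_def delete_edge_def)
    ultimately show "smult (ftilde n d f (s ` (edges (delete_edge G e) - A) \<union> {s e}))
        ((- 1) ^ card A * monom 1 (num_components (spanning (delete_edge G e) A))) = ?t A"
      by simp
  qed (simp add: delete_edge_def)
  have con: "wchrom n d f (contract_edge G e) s = - (\<Sum>A\<in>Pow (?E - {e}). ?t (insert e A))"
    unfolding wchrom_def sum_negf[symmetric]
  proof (rule sum.cong)
    fix A assume A: "A \<in> Pow (?E - {e})"
    \<comment> \<open>These facts make \<open>insert e A\<close> one larger than \<open>A\<close>,
      which is where the minus sign comes from; the weight and the number of components agree on
      both sides.\<close>
    then have "finite A" "e \<notin> A"
      using fin finite_subset by auto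
    moreover have "edges (contract_edge G e) - A = ?E - insert e A"
      by (auto simp: contract_edge_def)
    moreover have "num_components (spanning (contract_edge G e) A) =
        num_components (spanning G (insert e A))"
      using assms(1,4) A by (intro num_components_contract_edge) auto
    ultimately show "smult (ftilde n d f (s ` (edges (contract_edge G e) - A)))
        ((- 1) ^ card A * monom 1 (num_components (spanning (contract_edge G e) A))) =
        - ?t (insert e A)"
      by simp
  qed (simp add: contract_edge_def)
  show ?thesis
    unfolding del con
    unfolding wchrom_def sum_Pow_remove[OF fin assms(4)] by simp
qed

end
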